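(* Let $k \geq 10$ and let $S_1, S_2, \ldots, S_k$ be binary squares, i.e., each $S_i = x_i x_i$ for some nonempty word $x_i \in \{0,1\}^+$. Then the concatenation $S_1 S_2 \cdots S_k$ contains a factor that is an overlap. Moreover, the bound $10$ is optimal: there exists an overlap-free binary word that is a concatenation of $9$ binary squares.
   Context: A word $w$ is a square if $w = xx$ for some nonempty word $x$. A word is an overlap if it has the form $axaxa$ where $a$ is a single letter and $x$ is a (possibly empty) word. A factor of $w$ is a word $y$ such that $w = xyz$ for some words $x, z$. A word is overlap-free if none of its factors is an overlap. *)

theory Defs
  imports "HOL-Library.Sublist"
begin

type_synonym binary_word = "bool list"

definition square_word :: "'a list \<Rightarrow> bool" where
  "square_word w \<longleftrightarrow> (\<exists>x. x \<noteq> [] \<and> w = x @ x)"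

definition overlap_word :: "'a list \<Rightarrow> bool" where
  "overlap_word w \<longleftrightarrow> (\<exists>a x. w = [a] @ x @ [a] @ x @ [a])"

definition overlap_free :: "'a list \<Rightarrow> bool" where
  "overlap_free w \<longleftrightarrow> (\<forall>y. sublist y w \<longrightarrow> \<not> overlap_word y)"

end

theory Submission
  imports Defs
begin

text \<open>
  In an overlap-free binary word the interior positions \<open>i\<close> with \<open>w\<^sub>i = w\<^sub>i\<^sub>+\<^sub>1\<close> all have the
  same parity. Consider eight consecutive squares together with one letter of context on each side;
  every square starts at an odd position. If the repeated letters sit at odd positions, then all
  the roots are among 0, 1, 010 and 101, and a finite search rules this out. Otherwise
  the squares have roots of even length and are products of the blocks 01 and 10, so keeping one
  letter per block yields a shorter overlap-free product of eight squares with context, and infinite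
  descent applies. Ten squares contain eight with context.
\<close>

section \<open>Overlap-freeness in terms of positions, and an executable test\<close>

text \<open>An overlap \<open>axaxa\<close> is a window of length 2p+1 with period p, where p is the
  length of \<open>ax\<close>. The index form makes periods and parities of positions directly
  accessible.\<close>

lemma overlap_free_iff_nth:
  "overlap_free w \<longleftrightarrow>
    (\<forall>i p. 0 < p \<longrightarrow> i + 2 * p < length w \<longrightarrow> (\<exists>j\<le>p. w ! (i + j) \<noteq> w ! (i + p + j)))"
  (is "_ \<longleftrightarrow> ?R")
proof
  assume of: "overlap_free w"
  show ?R
  proof (intro allI impI, rule ccontr)
    fix i p :: nat
    assume p: "0 < p" and len: "i + 2 * p < length w"
      and "\<not> (\<exists>j\<le>p. w ! (i + j) \<noteq> w ! (i + p + j))"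
    then have per: "w ! (i + j) = w ! (i + p + j)" if "j \<le> p" for j
      using that by blast
    \<comment> \<open>\<open>u\<close> is the period block \<open>ax\<close>, so the window reads
      \<open>u @ u @ [a]\<close>.\<close>
    define u where "u = take p (drop i w)"
    define a where "a = w ! i"
    have lu: "length u = p" using len by (simp add: u_def)
    have u: "u ! j = w ! (i + j)" if "j < p" for j
      using that len by (simp add: u_def)
    have ua: "u = a # tl u"
      using lu p u[of 0] by (cases u) (auto simp: a_def)
    have y: "take (2 * p + 1) (drop i w) = u @ u @ [a]"
    proof (rule nth_equalityI)
      show "length (take (2 * p + 1) (drop i w)) = length (u @ u @ [a])"
        using len lu by simp
      fix j assume "j < length (take (2 * p + 1) (drop i w))"
      then have j: "j \<le> 2 * p" by simp
      then have L: "take (2 * p + 1) (drop i w) ! j = w ! (i + j)"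
        using len by simp
      consider "j < p" | "p \<le> j" "j < 2 * p" | "j = 2 * p" using j by linarith
      then show "take (2 * p + 1) (drop i w) ! j = (u @ u @ [a]) ! j"
      proof cases
        case 1
        then show ?thesis unfolding L by (simp add: nth_append lu u)
      next
        case 2
        then have "w ! (i + j) = w ! (i + (j - p))" using per[of "j - p"] by simp
        moreover have "j - p < p" using 2 by simp
        ultimately show ?thesis unfolding L using 2 by (simp add: nth_append lu u)
      next
        case 3
        have "w ! (i + 2 * p) = a"
          using per[of p] per[of 0] by (simp add: a_def mult_2 add.assoc)
        then show ?thesis unfolding L using 3 by (simp add: nth_append lu)
      qed
    qed
    have "overlap_word (u @ u @ [a])"
      unfolding overlap_word_def using ua by (metis append_Cons append_Nil)
    moreover have "sublist (u @ u @ [a]) w"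
      unfolding y[symmetric] by (meson sublist_take sublist_drop sublist_order.order.trans)
    ultimately show False using of by (auto simp: overlap_free_def)
  qed
next
  assume R: ?R
  show "overlap_free w"
    unfolding overlap_free_def overlap_word_def
  proof (intro allI impI notI, elim exE)
    fix y a x
    assume "sublist y w" and y: "y = [a] @ x @ [a] @ x @ [a]"
    then obtain ps ss where w: "w = ps @ y @ ss" by (auto simp: sublist_def)
    define u where "u = a # x"
    have yu: "y = u @ u @ [a]" by (simp add: y u_def)
    have "w ! (length ps + j) = w ! (length ps + length u + j)" if "j \<le> length u" for j
    proof (cases "j = length u")
      case True
      have "u ! 0 = a" "u \<noteq> []" by (simp_all add: u_def)
      then show ?thesis using True by (simp add: w yu nth_append)
    next
      case False
      then show ?thesis using that by (simp add: w yu nth_append)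
    qed
    moreover have "0 < length u" "length ps + 2 * length u < length w"
      by (simp_all add: w yu u_def)
    ultimately show False using R by blast
  qed
qed

lemma overlap_freeD:
  assumes "overlap_free w" "0 < p" "i + 2 * p < length w"
  obtains j where "j \<le> p" "w ! (i + j) \<noteq> w ! (i + p + j)"
  using assms overlap_free_iff_nth by blast

lemma overlap_free_sublist: "overlap_free w \<Longrightarrow> sublist v w \<Longrightarrow> overlap_free v"
  unfolding overlap_free_def by (meson sublist_order.order.trans)

text \<open>Two windows of length \<open>Suc p\<close> at distance \<open>p\<close> agree exactly
  when an overlap of period \<open>p\<close> stands at the front. The range of \<open>p\<close>
  keeps those overlaps that fit, so neither window is cut short.\<close>

fun overlap_free_exec :: "'a list \<Rightarrow> bool" where
  "overlap_free_exec [] = True"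
| "overlap_free_exec (x # xs) =
    (list_all (\<lambda>p. take (Suc p) (x # xs) \<noteq> take (Suc p) (drop p (x # xs)))
      [1..<Suc (length xs div 2)] \<and> overlap_free_exec xs)"

lemma overlap_free_Cons:
  "overlap_free (x # xs) \<longleftrightarrow>
    (\<forall>p. 0 < p \<longrightarrow> 2 * p \<le> length xs \<longrightarrow> (\<exists>j\<le>p. (x # xs) ! j \<noteq> (x # xs) ! (p + j))) \<and>
    overlap_free xs"
  (is "_ \<longleftrightarrow> ?P \<and> _")
proof
  assume A: "overlap_free (x # xs)"
  have "\<exists>j\<le>p. (x # xs) ! j \<noteq> (x # xs) ! (p + j)" if "0 < p" "2 * p \<le> length xs" for p
    using overlap_freeD[OF A, of p 0] that by auto
  moreover have "overlap_free xs"
    using A by (rule overlap_free_sublist) (simp add: sublist_Cons_right)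
  ultimately show "?P \<and> overlap_free xs" by blast
next
  assume A: "?P \<and> overlap_free xs"
  show "overlap_free (x # xs)"
    unfolding overlap_free_iff_nth
  proof (intro allI impI)
    fix i p :: nat
    assume "0 < p" "i + 2 * p < length (x # xs)"
    then show "\<exists>j\<le>p. (x # xs) ! (i + j) \<noteq> (x # xs) ! (i + p + j)"
      using A overlap_freeD[of xs p "i - 1"] by (cases i) auto
  qed
qed

lemma overlap_free_exec: "overlap_free w \<longleftrightarrow> overlap_free_exec w"
proof (induction w)
  case Nil
  then show ?case by (simp add: overlap_free_def overlap_word_def)
next
  case (Cons x xs)
  have eq: "take (Suc p) w \<noteq> take (Suc p) (drop p w) \<longleftrightarrow> (\<exists>j\<le>p. w ! j \<noteq> w ! (p + j))"
    if "2 * p < length w" for p and w :: "'a list"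
    using that by (auto simp: list_eq_iff_nth_eq less_Suc_eq_le)
  have "p \<in> set [1..<Suc (length xs div 2)] \<longleftrightarrow> 0 < p \<and> 2 * p < length (x # xs)" for p
    by auto
  then show ?case
    unfolding overlap_free_Cons overlap_free_exec.simps Cons.IH list_all_iff
    using eq[of _ "x # xs"] by (metis length_Cons less_Suc_eq_le)
qed

section \<open>Short overlaps and the parity of doubled letters\<close>

text \<open>Periods 1, 2 and 3 are written out letter by letter, so that over a two-letter alphabet
  the later contradictions become propositional.\<close>

lemma overlap_free_no_short_overlap:
  assumes "overlap_free w"
  shows "n + 2 < length w \<Longrightarrow> \<not> (w ! n = w ! (n + 1) \<and> w ! (n + 1) = w ! (n + 2))"
    and "n + 4 < length w \<Longrightarrow>
      \<not> (w ! n = w ! (n + 2) \<and> w ! (n + 1) = w ! (n + 3) \<and> w ! (n + 2) = w ! (n + 4))"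
    and "n + 6 < length w \<Longrightarrow>
      \<not> (w ! n = w ! (n + 3) \<and> w ! (n + 1) = w ! (n + 4) \<and> w ! (n + 2) = w ! (n + 5) \<and>
         w ! (n + 3) = w ! (n + 6))"
proof -
  assume "n + 2 < length w"
  then obtain j where j: "j \<le> 1" "w ! (n + j) \<noteq> w ! (n + 1 + j)"
    using overlap_freeD[OF assms, of 1 n] by auto
  then have "j = 0 \<or> j = 1" by linarith
  then show "\<not> (w ! n = w ! (n + 1) \<and> w ! (n + 1) = w ! (n + 2))"
    using j(2) by (elim disjE) (simp_all add: eval_nat_numeral)
next
  assume "n + 4 < length w"
  then obtain j where j: "j \<le> 2" "w ! (n + j) \<noteq> w ! (n + 2 + j)"
    using overlap_freeD[OF assms, of 2 n] by auto
  then have "j = 0 \<or> j = 1 \<or> j = 2" by linarith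
  then show "\<not> (w ! n = w ! (n + 2) \<and> w ! (n + 1) = w ! (n + 3) \<and> w ! (n + 2) = w ! (n + 4))"
    using j(2) by (elim disjE) (simp_all add: eval_nat_numeral)
next
  assume "n + 6 < length w"
  then obtain j where j: "j \<le> 3" "w ! (n + j) \<noteq> w ! (n + 3 + j)"
    using overlap_freeD[OF assms, of 3 n] by auto
  then have "j = 0 \<or> j = 1 \<or> j = 2 \<or> j = 3" by linarith
  then show "\<not> (w ! n = w ! (n + 3) \<and> w ! (n + 1) = w ! (n + 4) \<and> w ! (n + 2) = w ! (n + 5) \<and>
      w ! (n + 3) = w ! (n + 6))"
    using j(2) by (elim disjE) (simp_all add: eval_nat_numeral)
qed

lemma overlap_free_no_alternation:
  fixes w :: binary_word
  assumes "overlap_free w" "n + 4 < length w"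
  shows "\<exists>k\<in>{n, n + 1, n + 2, n + 3}. w ! k = w ! (k + 1)"
proof (rule ccontr)
  assume "\<not> ?thesis"
  then have "w ! n \<noteq> w ! (n + 1)" "w ! (n + 1) \<noteq> w ! (n + 2)"
    "w ! (n + 2) \<noteq> w ! (n + 3)" "w ! (n + 3) \<noteq> w ! (n + 4)"
    by (simp_all add: eval_nat_numeral)
  with overlap_free_no_short_overlap(2)[OF assms] show False by argo
qed

text \<open>By induction on the distance, only consecutive doubles matter, and between them the
  letters alternate. Distance 1 gives a cube, distance 3 gives abbabba, and distance 5 or more gives
  ababa, which leaves 2 and 4.\<close>

lemma even_distance_between_doubles:
  fixes w :: binary_word
  assumes of: "overlap_free w"
  shows "1 \<le> i \<Longrightarrow> i < j \<Longrightarrow> j + 2 < length w \<Longrightarrow> w ! i = w ! (i + 1) \<Longrightarrow>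
    w ! j = w ! (j + 1) \<Longrightarrow> even (i + j)"
proof (induction "j - i" arbitrary: i j rule: less_induct)
  case less
  note cube = overlap_free_no_short_overlap(1)[OF of]
  show ?case
  proof (cases "\<exists>k. i < k \<and> k < j \<and> w ! k = w ! (k + 1)")
    case True
    then obtain k where k: "i < k" "k < j" "w ! k = w ! (k + 1)" by blast
    have "even (i + k)" using less.hyps[of k i] less.prems k by simp
    moreover have "even (k + j)" using less.hyps[of j k] less.prems k by simp
    ultimately show ?thesis by presburger
  next
    case False
    then have alt: "w ! k \<noteq> w ! (k + 1)" if "i < k" "k < j" for k using that by blast
    have "j \<noteq> i + 1" using cube[of i] less.prems by auto
    moreover have "j \<noteq> i + 3"
    proof
      assume j: "j = i + 3"
      \<comment> \<open>The overlap abbabba uses one letter on either side of abbab b; the bounds on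
        \<open>i\<close> and \<open>j\<close> guarantee that both letters exist.\<close>
      define h where "h = i - 1"
      have i: "i = h + 1" using less.prems(1) by (simp add: h_def)
      have len: "h + 6 < length w" using less.prems(3) by (simp add: i j)
      have "w ! (h + 1) = w ! (h + 2)" "w ! (h + 4) = w ! (h + 5)"
        using less.prems(4,5) by (simp_all add: i j eval_nat_numeral)
      moreover from this have "w ! h \<noteq> w ! (h + 1)" "w ! (h + 5) \<noteq> w ! (h + 6)"
        using cube[of h] cube[of "h + 4"] len by (simp_all add: eval_nat_numeral)
      moreover have "w ! (h + 2) \<noteq> w ! (h + 3)" "w ! (h + 3) \<noteq> w ! (h + 4)"
        using alt[of "i + 1"] alt[of "i + 2"] by (simp_all add: i j eval_nat_numeral)
      ultimately show False using overlap_free_no_short_overlap(3)[OF of len] by argo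
    qed
    moreover have "j < i + 5"
    proof (rule ccontr)
      assume j: "\<not> j < i + 5"
      then have "i + 1 + 4 < length w" using less.prems(3) by simp
      then obtain k where k: "k \<in> {i + 1, i + 1 + 1, i + 1 + 2, i + 1 + 3}" "w ! k = w ! (k + 1)"
        using overlap_free_no_alternation[OF of] by blast
      then have "i < k" "k < j" using j by auto
      with alt k(2) show False by blast
    qed
    ultimately have "j = i + 2 \<or> j = i + 4" using less.prems by linarith
    then show ?thesis by auto
  qed
qed

section \<open>Possible roots of a square in context\<close>

lemma nth_square_context:
  assumes "w = P @ x @ x @ Q" "j < length x"
  shows "w ! (length P + j) = x ! j" "w ! (length P + length x + j) = x ! j"
  using assms by (auto simp: nth_append)

text \<open>If the root had odd length, its two copies would start at positions of different parity,
  so together they would make every adjacent pair of \<open>x\<close> a block and force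
  \<open>x\<close> to alternate. Its first and last letters would then agree, but the seam between
  the copies is a block as well.\<close>

lemma even_root_if_aligned:
  fixes w :: binary_word
  assumes w: "w = P @ x @ x @ Q" and "odd (length P)" and "x \<noteq> []" and "Q \<noteq> []"
    and block: "\<And>t. odd t \<Longrightarrow> t + 2 < length w \<Longrightarrow> w ! t \<noteq> w ! (t + 1)"
  shows "even (length x)"
proof (rule ccontr)
  define m where "m = length x"
  assume "odd (length x)"
  then have m: "odd m" by (simp add: m_def)
  note nth = nth_square_context[OF w, folded m_def]
  have len: "length P + 2 * m + 1 \<le> length w"
    using \<open>Q \<noteq> []\<close> by (cases Q) (simp_all add: w m_def)
  have alt: "x ! j \<noteq> x ! Suc j" if "Suc j < m" for j
  proof (cases "even j")
    case True
    then show ?thesis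
      using block[of "length P + j"] nth[of j] nth[of "Suc j"] that len \<open>odd (length P)\<close> by simp
  next
    case False
    then show ?thesis
      using block[of "length P + m + j"] nth[of j] nth[of "Suc j"] that len \<open>odd (length P)\<close> m by simp
  qed
  have "x ! j = (x ! 0 = even j)" if "j < m" for j
    using that by (induction j) (use alt in auto)
  from this[of "m - 1"] have "x ! (m - 1) = x ! 0"
    using m by (cases m) auto
  moreover have "x ! (m - 1) \<noteq> x ! 0"
    using block[of "length P + (m - 1)"] nth[of "m - 1"] nth[of 0] len \<open>odd (length P)\<close> m
    by (cases m) auto
  ultimately show False by simp
qed

text \<open>A root of even length extends to an overlap by the letter before or after the square. A
  root of odd length alternates, as its copies start at different parities, so it has length 1 or
  3.\<close>

lemma root_if_misaligned:
  fixes w :: binary_word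
  assumes of: "overlap_free w"
    and w: "w = P @ x @ x @ Q" and P: "odd (length P)" and "x \<noteq> []" and "Q \<noteq> []"
    and PQ: "2 \<le> length P \<or> 2 \<le> length Q"
    and block: "\<And>t. even t \<Longrightarrow> 2 \<le> t \<Longrightarrow> t + 2 < length w \<Longrightarrow> w ! t \<noteq> w ! (t + 1)"
  shows "x \<in> {[False], [True], [False, True, False], [True, False, True]}"
proof -
  define m where "m = length x"
  note nth = nth_square_context[OF w, folded m_def]
  have m0: "0 < m" using \<open>x \<noteq> []\<close> by (simp add: m_def)
  have len: "length w = length P + 2 * m + length Q" by (simp add: w m_def)
  have lQ: "1 \<le> length Q" using \<open>Q \<noteq> []\<close> by (simp add: Suc_leI)
  have lP: "1 \<le> length P" using P by (cases P) simp_all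
  have m: "odd m"
  proof
    assume ev: "even m"
    then have m2: "2 \<le> m" using m0 by presburger
    have ends: "x ! (m - 1) \<noteq> x ! 0"
    proof -
      have "length P + (m - 1) + 1 = length P + m + 0" using m0 by simp
      then show ?thesis
        using block[of "length P + (m - 1)"] nth(1)[of "m - 1"] nth(2)[of 0] len lP lQ P ev m2 by simp
    qed
    from PQ show False
    proof
      \<comment> \<open>The letter before the square differs from the first letter of
        \<open>x\<close>. As that one differs from the last letter, the preceding letter equals the
        last one and turns the square into an overlap of period \<open>m\<close>.\<close>
      assume "2 \<le> length P"
      define e where "e = length P - 1"
      have e: "length P = e + 1" "even e" "2 \<le> e"
        using P \<open>2 \<le> length P\<close> by (auto simp: e_def elim!: oddE)
      have "w ! e \<noteq> x ! 0" using block[of e] e len m2 nth(1)[of 0] by simp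
      then have last: "w ! e = x ! (m - 1)" using ends by blast
      have "e + 2 * m < length w" using len e lQ by linarith
      then obtain j where j: "j \<le> m" "w ! (e + j) \<noteq> w ! (e + m + j)"
        using overlap_freeD[OF of m0] by blast
      show False
      proof (cases j)
        case 0
        then show False using j last nth(1)[of "m - 1"] e m0 by simp
      next
        case (Suc i)
        then show False using j nth[of i] e by (simp add: ac_simps)
      qed
    next
      \<comment> \<open>Mirror image: the letter after the square equals the first letter of
        \<open>x\<close>.\<close>
      assume "2 \<le> length Q"
      let ?e = "length P + m + (m - 1)"
      have "w ! ?e \<noteq> w ! (?e + 1)"
        by (rule block) (use P ev m2 len \<open>2 \<le> length Q\<close> lP in auto)
      moreover have "w ! ?e = x ! (m - 1)" using nth(2)[of "m - 1"] m0 by simp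
      moreover have "?e + 1 = length P + m + m" using m0 by simp
      ultimately have last: "w ! (length P + m + m) = x ! 0" using ends by metis
      have "length P + 2 * m < length w" using len lQ by linarith
      then obtain j where j: "j \<le> m" "w ! (length P + j) \<noteq> w ! (length P + m + j)"
        using overlap_freeD[OF of m0] by blast
      show False
      proof (cases "j = m")
        case True
        then show False using j last nth(2)[of 0] m0 by simp
      next
        case False
        then show False using j nth[of j] by simp
      qed
    qed
  qed
  have alt: "x ! j \<noteq> x ! (j + 1)" if "j + 1 < m" for j
  proof (cases "odd j")
    case True
    then have "0 < j" by (cases j) auto
    then show ?thesis
      using block[of "length P + j"] nth(1)[of j] nth(1)[of "Suc j"] that len P lP lQ True by simp
  next
    case False
    then show ?thesis
      using block[of "length P + m + j"] nth(2)[of j] nth(2)[of "Suc j"] that len P lP lQ m by simp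
  qed
  have "m < 5"
  proof (rule ccontr)
    assume m5: "\<not> m < 5"
    have "sublist x w" unfolding w by (meson sublist_appendI sublist_append_leftI)
    then have "overlap_free x" using of overlap_free_sublist by blast
    moreover have "0 + 4 < length x" using m5 by (simp add: m_def)
    ultimately obtain k where k: "k \<in> {0, 0 + 1, 0 + 2, 0 + 3}" "x ! k = x ! (k + 1)"
      using overlap_free_no_alternation by blast
    then have "k + 1 < m" using m5 by auto
    then show False using alt k(2) by blast
  qed
  then have "m = 1 \<or> m = 3" using m by presburger
  then show ?thesis
  proof
    assume "m = 1"
    then show ?thesis by (auto simp: m_def length_Suc_conv)
  next
    assume m3: "m = 3"
    then obtain a b c where x: "x = [a, b, c]" by (auto simp: m_def eval_nat_numeral length_Suc_conv)
    show ?thesis using alt[of 0] alt[of 1] m3 by (auto simp: x)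
  qed
qed

section \<open>Finite search over the squares of odd root\<close>

definition odd_squares :: "binary_word list" where
  "odd_squares = [[False, False], [True, True],
    [False, True, False, False, True, False], [True, False, True, True, False, True]]"

text \<open>The search grows a word to the left and keeps only overlap-free extensions; it starts
  from the right context letter, and the base case tries both left context letters.\<close>

fun square_extendable :: "nat \<Rightarrow> binary_word \<Rightarrow> bool" where
  "square_extendable 0 w \<longleftrightarrow> overlap_free_exec (False # w) \<or> overlap_free_exec (True # w)"
| "square_extendable (Suc n) w \<longleftrightarrow>
    list_ex (\<lambda>s. overlap_free_exec (s @ w) \<and> square_extendable n (s @ w)) odd_squares"

lemma square_extendable_if_overlap_free:
  assumes "set Ss \<subseteq> set odd_squares" "overlap_free (a # concat Ss @ w)"
  shows "square_extendable (length Ss) w"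
  using assms
proof (induction Ss arbitrary: w rule: rev_induct)
  case Nil
  then show ?case by (cases a) (simp_all flip: overlap_free_exec)
next
  case (snoc S Ss)
  have "square_extendable (length Ss) (S @ w)" using snoc by simp
  moreover have "overlap_free (S @ w)"
    using snoc.prems(2) by (rule overlap_free_sublist) (simp add: sublist_Cons_right)
  ultimately show ?case
    using snoc.prems(1) by (auto simp: list_ex_iff simp flip: overlap_free_exec)
qed

lemma not_square_extendable:
  "\<not> square_extendable 8 [False]" "\<not> square_extendable 8 [True]"
  by code_simp+

lemma no_eight_odd_squares:
  assumes "set Ss \<subseteq> set odd_squares" "length Ss = 8"
  shows "\<not> overlap_free (a # concat Ss @ [b])"
  using square_extendable_if_overlap_free[of Ss a "[b]"] not_square_extendable assms
  by (cases b) auto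

section \<open>Keeping one letter per block\<close>

text \<open>On products of the blocks 01 and 10 this inverts the Thue-Morse morphism 0 -> 01, 1 ->
  10.\<close>

fun evens :: "'a list \<Rightarrow> 'a list" where
  "evens (x # y # xs) = x # evens xs"
| "evens xs = []"

lemma length_evens [simp]: "length (evens xs) = length xs div 2"
  by (induction xs rule: evens.induct) auto

lemma nth_evens: "t < length xs div 2 \<Longrightarrow> evens xs ! t = xs ! (2 * t)"
proof (induction xs arbitrary: t rule: evens.induct)
  case (1 x y xs)
  then show ?case by (cases t) auto
qed auto

lemma evens_append: "even (length xs) \<Longrightarrow> evens (xs @ ys) = evens xs @ evens ys"
  by (induction xs rule: evens.induct) auto

lemma evens_concat:
  "(\<And>S. S \<in> set Ss \<Longrightarrow> even (length S)) \<Longrightarrow> evens (concat Ss) = concat (map evens Ss)"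
  by (induction Ss) (auto simp: evens_append)

lemma even_length_concat:
  "(\<And>S. S \<in> set Ss \<Longrightarrow> even (length S)) \<Longrightarrow> even (length (concat Ss))"
  by (induction Ss) auto

lemma overlap_free_evens:
  fixes c :: binary_word
  assumes of: "overlap_free (a # c @ [b])" and len: "4 dvd length c"
    and block: "\<And>t. odd t \<Longrightarrow> t + 2 < length (a # c @ [b]) \<Longrightarrow>
      (a # c @ [b]) ! t \<noteq> (a # c @ [b]) ! (t + 1)"
  shows "overlap_free ((\<not> a) # evens c @ [b])"
  \<comment> \<open>The context letter \<open>a\<close> ends a block that would begin with its complement, and \<open>b\<close> begins one.\<close>
proof -
  define w where "w = a # c @ [b]"
  define v where "v = (\<not> a) # evens c @ [b]"
  obtain n where n: "length c = 4 * n" using len by blast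
  have lw: "length w = 4 * n + 2" and lv: "length v = 2 * n + 2"
    by (simp_all add: w_def v_def n)
  \<comment> \<open>By \<open>v1\<close> and \<open>v0\<close>, \<open>w\<close> is the Thue-Morse
    image of \<open>v\<close> without its first and last letters.\<close>
  have v1: "w ! (2 * k + 1) = v ! (k + 1)" if "k + 1 < length v" for k
  proof (cases "k < 2 * n")
    case True
    then show ?thesis by (simp add: w_def v_def nth_append n nth_evens)
  next
    case False
    then have "k = 2 * n" using that lv by simp
    then show ?thesis by (simp add: w_def v_def nth_append n)
  qed
  have v0: "w ! (2 * k) = (\<not> v ! k)" if "k + 1 < length v" for k
  proof (cases k)
    case 0
    then show ?thesis by (simp add: w_def v_def)
  next
    case (Suc i)
    have "w ! (2 * i + 1) \<noteq> w ! (2 * i + 1 + 1)"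
      using block[folded w_def, of "2 * i + 1"] that Suc lv lw by simp
    then show ?thesis using v1[of i] that Suc by auto
  qed
  have "overlap_free v"
    unfolding overlap_free_iff_nth
  proof (intro allI impI, rule ccontr)
    fix i p :: nat
    assume p: "0 < p" and ip: "i + 2 * p < length v"
      and "\<not> (\<exists>j\<le>p. v ! (i + j) \<noteq> v ! (i + p + j))"
    then have per: "v ! (i + j) = v ! (i + p + j)" if "j \<le> p" for j using that by blast
    show False
    proof (cases "i + 2 * p + 1 < length v")
      case True
      \<comment> \<open>An overlap of period \<open>p\<close> in \<open>v\<close> that stops before
        the last letter gives one of period \<open>2 * p\<close> in \<open>w\<close>, starting at
        the second letter of the block of \<open>v ! i\<close>.\<close>
      have "2 * i + 2 * (2 * p) < length w" using True lv lw by simp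
      then obtain j where j: "j \<le> 2 * p" "w ! (2 * i + j) \<noteq> w ! (2 * i + 2 * p + j)"
        using overlap_freeD[of w "2 * p" "2 * i"] of p by (auto simp: w_def)
      show False
      proof (cases "even j")
        case True
        then obtain k where k: "j = 2 * k" by blast
        then show False
          using j v0[of "i + k"] v0[of "i + p + k"] per[of k] \<open>i + 2 * p + 1 < length v\<close>
          by (simp add: algebra_simps)
      next
        case False
        then obtain k where k: "j = 2 * k + 1" by (elim oddE)
        then show False
          using j v1[of "i + k"] v1[of "i + p + k"] per[of "k + 1"] \<open>i + 2 * p + 1 < length v\<close>
          by (simp add: algebra_simps)
      qed
    next
      case False
      \<comment> \<open>Now the overlap is a suffix of \<open>v\<close>. The length of
        \<open>v\<close> is even because 4 divides that of \<open>c\<close>, so \<open>i\<close> is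
        odd, hence positive, and the window in \<open>w\<close> can start at the first letter of the
        block of \<open>v ! i\<close>.\<close>
      then have eq: "i + 2 * p = 2 * n + 1" using ip lv by simp
      then obtain h where h: "i = h + 1" by (cases i) (presburger, auto)
      have "2 * h + 1 + 2 * (2 * p) < length w" using eq lw h by simp
      then obtain j where j: "j \<le> 2 * p" "w ! (2 * h + 1 + j) \<noteq> w ! (2 * h + 1 + 2 * p + j)"
        using overlap_freeD[of w "2 * p" "2 * h + 1"] of p by (auto simp: w_def)
      show False
      proof (cases "even j")
        case True
        then obtain k where k: "j = 2 * k" by blast
        then show False
          using j v1[of "h + k"] v1[of "h + p + k"] per[of k] h ip
          by (simp add: algebra_simps)
      next
        case False
        then obtain k where k: "j = 2 * k + 1" by (elim oddE)
        then show False
          using j v0[of "h + k + 1"] v0[of "h + p + k + 1"] per[of k] h ip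
          by (simp add: algebra_simps)
      qed
    qed
  qed
  then show ?thesis by (simp add: v_def)
qed

section \<open>Infinite descent for eight squares\<close>

text \<open>The context letters vary in the induction, since each halving complements the left
  one.\<close>

lemma not_overlap_free_eight_squares:
  fixes Ss :: "binary_word list"
  assumes "length Ss = 8" "\<forall>S\<in>set Ss. square_word S"
  shows "\<not> overlap_free (a # concat Ss @ [b])"
  using assms
proof (induction "length (concat Ss)" arbitrary: Ss a b rule: less_induct)
  case less
  define w where "w = a # concat Ss @ [b]"
  have even_sq: "even (length S)" if "S \<in> set Ss" for S
    using less.prems that by (auto simp: square_word_def)
  show ?case
  proof
    assume "overlap_free (a # concat Ss @ [b])"
    then have of: "overlap_free w" by (simp add: w_def)
    have split: "\<exists>P Q x. w = P @ x @ x @ Q \<and> S = x @ x \<and> odd (length P) \<and> x \<noteq> [] \<and> Q \<noteq> [] \<and>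
      (2 \<le> length P \<or> 2 \<le> length Q)" if "S \<in> set Ss" for S
    proof -
      obtain As Bs where Ss: "Ss = As @ S # Bs" using \<open>S \<in> set Ss\<close> by (meson split_list)
      obtain x where x: "x \<noteq> []" "S = x @ x"
        using less.prems \<open>S \<in> set Ss\<close> by (auto simp: square_word_def)
      have "even (length (concat As))"
        by (rule even_length_concat) (use even_sq Ss in auto)
      \<comment> \<open>Another square is present, so some side has more than the single context
        letter; \<open>root_if_misaligned\<close> relies on this.\<close>
      moreover have "concat As \<noteq> [] \<or> concat Bs \<noteq> []"
      proof -
        have "As \<noteq> [] \<or> Bs \<noteq> []" using less.prems(1) Ss by auto
        then obtain T where "T \<in> set As \<union> set Bs" by (metis Un_iff list.set_intros(1) neq_Nil_conv)
        moreover from this have "T \<noteq> []" using less.prems(2) Ss by (auto simp: square_word_def)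
        ultimately show ?thesis by auto
      qed
      then have "2 \<le> length (a # concat As) \<or> 2 \<le> length (concat Bs @ [b])"
        by (cases "concat As"; cases "concat Bs") auto
      moreover have "w = (a # concat As) @ x @ x @ (concat Bs @ [b])"
        by (simp add: w_def Ss x)
      ultimately show ?thesis
        using x by (intro exI[of _ "a # concat As"] exI[of _ "concat Bs @ [b]"] exI[of _ x]) simp
    qed
    show False
    proof (cases "\<exists>i. odd i \<and> i + 2 < length w \<and> w ! i = w ! (i + 1)")
      case True
      then obtain i where i: "odd i" "i + 2 < length w" "w ! i = w ! (i + 1)" by blast
      \<comment> \<open>One double at an odd position excludes those at even positions. Position 0
        stays out, as the parity argument needs a letter to the left.\<close>
      have block: "w ! t \<noteq> w ! (t + 1)" if t: "even t" "2 \<le> t" "t + 2 < length w" for t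
      proof
        assume "w ! t = w ! (t + 1)"
        moreover have "1 \<le> i" using i(1) by (cases i) auto
        moreover have "t < i \<or> i < t" using i(1) t(1) by (metis linorder_neqE_nat)
        ultimately have "even (t + i) \<or> even (i + t)"
          using even_distance_between_doubles[OF of, of t i]
            even_distance_between_doubles[OF of, of i t] i t by auto
        then show False using i t by simp
      qed
      have "set Ss \<subseteq> set odd_squares"
      proof
        fix S assume "S \<in> set Ss"
        then obtain P Q x where S: "w = P @ x @ x @ Q" "S = x @ x" "odd (length P)" "x \<noteq> []"
          "Q \<noteq> []" "2 \<le> length P \<or> 2 \<le> length Q"
          using split by blast
        have "x \<in> {[False], [True], [False, True, False], [True, False, True]}"
          by (rule root_if_misaligned[OF of S(1,3-6) block])
        then show "S \<in> set odd_squares" by (auto simp: S(2) odd_squares_def)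
      qed
      then show False
        using no_eight_odd_squares less.prems(1) of by (auto simp: w_def)
    next
      case False
      then have block: "w ! t \<noteq> w ! (t + 1)" if "odd t" "t + 2 < length w" for t
        using that by blast
      have root: "\<exists>x. S = x @ x \<and> x \<noteq> [] \<and> even (length x)" if "S \<in> set Ss" for S
        using split[OF that] even_root_if_aligned[OF _ _ _ _ block] by metis
      have evens_sq: "square_word (evens S)" if S: "S \<in> set Ss" for S
      proof -
        obtain x where x: "S = x @ x" "x \<noteq> []" "even (length x)" using root[OF S] by blast
        then have "length x \<ge> 2" by (cases x) (auto elim!: oddE evenE)
        then have "evens x \<noteq> []"
          by (metis length_evens div_greater_zero_iff length_greater_0_conv zero_less_numeral)
        then show ?thesis using x by (auto simp: square_word_def evens_append)
      qed
      have "4 dvd length (concat Ss)"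
      proof -
        have "4 dvd length S" if "S \<in> set Ss" for S
          using root[OF that] by (auto elim!: evenE)
        then show ?thesis by (induction Ss) auto
      qed
      moreover have "evens (concat Ss) = concat (map evens Ss)"
        by (rule evens_concat[OF even_sq])
      ultimately have "overlap_free ((\<not> a) # concat (map evens Ss) @ [b])"
        using overlap_free_evens[of a "concat Ss" b] of block by (simp add: w_def)
      moreover have "length (concat (map evens Ss)) < length (concat Ss)"
      proof -
        have "Ss \<noteq> []" using less.prems(1) by auto
        then have "concat Ss \<noteq> []"
          using less.prems(2) by (cases Ss) (auto simp: square_word_def)
        then show ?thesis
          unfolding \<open>evens (concat Ss) = _\<close>[symmetric] length_evens by (simp add: div_less_dividend)
      qed
      ultimately show False
        using less.hyps[of "map evens Ss" "\<not> a" b] less.prems evens_sq by auto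
    qed
  qed
qed

section \<open>Nine squares without overlap, and the bound ten\<close>

text \<open>The seven inner roots are the Thue-Morse images of 1, 0, 1, 010, 1, 0, 1. The roots 001
  and 011 at the two ends have odd length and are not among those of
  \<open>root_if_misaligned\<close>.\<close>

definition nine_squares :: "binary_word list" where
  "nine_squares = map (\<lambda>x. x @ x)
    [[False, False, True], [True, False], [False, True], [True, False],
     [False, True, True, False, False, True],
     [True, False], [False, True], [True, False], [False, True, True]]"

lemma overlap_free_nine_squares: "overlap_free (concat nine_squares)"
  unfolding overlap_free_exec by code_simp

theorem theorem1:
  shows "(\<forall>k \<ge> 10. \<forall>Ss :: binary_word list.
            length Ss = k \<and> (\<forall>S \<in> set Ss. square_word S) \<longrightarrow>
            (\<exists>y. sublist y (concat Ss) \<and> overlap_word y)) \<and>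
         (\<exists>Ss :: binary_word list.
            length Ss = 9 \<and> (\<forall>S \<in> set Ss. square_word S) \<and> overlap_free (concat Ss))"
proof (intro conjI allI impI; (elim conjE)?)
  fix k :: nat and Ss :: "binary_word list"
  assume k: "10 \<le> k" "length Ss = k" and sq: "\<forall>S\<in>set Ss. square_word S"
  \<comment> \<open>The second to ninth squares. The last letter of the first square and the first
    letter of the tenth serve as context.\<close>
  define Ts where "Ts = take 8 (drop 1 Ss)"
  have Ss: "Ss = Ss ! 0 # Ts @ Ss ! 9 # drop 10 Ss"
  proof -
    have "drop 1 Ss = Ts @ drop 9 Ss"
      using append_take_drop_id[of 8 "drop 1 Ss"] by (simp add: Ts_def)
    then show ?thesis
      using k Cons_nth_drop_Suc[of 0 Ss] Cons_nth_drop_Suc[of 9 Ss] by simp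
  qed
  have "Ss ! 0 \<noteq> []" "Ss ! 9 \<noteq> []"
  proof -
    have "Ss ! 0 \<in> set Ss" "Ss ! 9 \<in> set Ss" using k by simp_all
    then have "square_word (Ss ! 0)" "square_word (Ss ! 9)" using sq by blast+
    then show "Ss ! 0 \<noteq> []" "Ss ! 9 \<noteq> []" by (auto simp: square_word_def)
  qed
  then obtain u a b v where uv: "Ss ! 0 = u @ [a]" "Ss ! 9 = b # v"
    by (metis neq_Nil_conv rev_exhaust)
  have "concat Ss = u @ (a # concat Ts @ [b]) @ (v @ concat (drop 10 Ss))"
    by (subst Ss) (simp add: uv)
  then have sub: "sublist (a # concat Ts @ [b]) (concat Ss)" by (metis sublist_appendI)
  have "set Ts \<subseteq> set Ss" by (metis Ts_def set_take_subset set_drop_subset subset_trans)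
  then have "\<not> overlap_free (a # concat Ts @ [b])"
    using sq k by (intro not_overlap_free_eight_squares) (auto simp: Ts_def)
  then have "\<not> overlap_free (concat Ss)" using sub overlap_free_sublist by blast
  then show "\<exists>y. sublist y (concat Ss) \<and> overlap_word y" by (auto simp: overlap_free_def)
next
  show "\<exists>Ss :: binary_word list.
      length Ss = 9 \<and> (\<forall>S\<in>set Ss. square_word S) \<and> overlap_free (concat Ss)"
  proof (intro exI conjI)
    show "length nine_squares = 9" by (simp add: nine_squares_def)
    show "\<forall>S\<in>set nine_squares. square_word S"
    proof
      fix S assume "S \<in> set nine_squares"
      then obtain x where "x \<noteq> []" "S = x @ x"
        unfolding nine_squares_def set_map by (elim imageE) auto
      then show "square_word S" by (auto simp: square_word_def)
    qed
    show "overlap_free (concat nine_squares)" by (rule overlap_free_nine_squares)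
  qed
qed

end
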